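(* Let $a,b,c$ be nonnegative integers with $c\ge1$, and let $x_1,\ldots,x_{a+c},y_1,\ldots,y_{b+c}$ be indeterminates. Then, as rational functions, \[ \sum_{\Gamma=(\gamma_1,\ldots,\gamma_c)}\ \prod_{(i,j)\in\Gamma}\frac{1}{x_i-y_j}=\sum_{\Theta=(\theta_1,\ldots,\theta_c)}\ \prod_{(i,j)\in\Theta}\frac{1}{x_i-y_j}, \] where the left sum is over $c$-tuples of pairwise non-intersecting lattice paths in the grid $\{1,\ldots,a+c\}\times\{1,\ldots,b+c\}$ with $\gamma_p$ going from cell $(a+p,1)$ to cell $(p,b+c)$ using steps $(i,j)\to(i-1,j)$ and $(i,j)\to(i,j+1)$, and the right sum is over $c$-tuples of pairwise non-intersecting lattice paths with $\theta_p$ going from cell $(p,1)$ to cell $(a+p,b+c)$ using steps $(i,j)\to(i+1,j)$ and $(i,j)\to(i,j+1)$.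
   Context: Cells $(i,j)$ index row $i$ and column $j$ of the $(a+c)\times(b+c)$ grid. A lattice path is identified with its set of cells; paths are non-intersecting if they share no cell. The product over $(i,j)\in\Gamma$ is over all cells lying on some path of the tuple. *)

theory Defs
  imports
    "HOL-Library.Poly_Mapping"
    "HOL-Library.FuncSet"
    "HOL-Library.Disjoint_Sets"
    "HOL-Computational_Algebra.Fraction_Field"
begin

datatype indet = X_ind nat | Y_ind nat

text \<open>
  The linear order on the names of the indeterminates is only used to obtain the
  instance that polynomials, i.e. finitely supported maps from monomials to
  coefficients, form an integral domain.
\<close>

instantiation indet :: linorder
begin

fun less_eq_indet :: "indet \<Rightarrow> indet \<Rightarrow> bool" where
  "X_ind i \<le> X_ind j \<longleftrightarrow> i \<le> j"
| "X_ind i \<le> Y_ind j \<longleftrightarrow> True"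
| "Y_ind i \<le> X_ind j \<longleftrightarrow> False"
| "Y_ind i \<le> Y_ind j \<longleftrightarrow> i \<le> j"

definition less_indet :: "indet \<Rightarrow> indet \<Rightarrow> bool" where
  "u < v \<longleftrightarrow> u \<le> v \<and> \<not> v \<le> (u :: indet)"

instance
proof
  fix u v w :: indet
  show "u < v \<longleftrightarrow> u \<le> v \<and> \<not> v \<le> u" by (rule less_indet_def)
  show "u \<le> u" by (cases u) auto
  show "u \<le> v \<Longrightarrow> v \<le> w \<Longrightarrow> u \<le> w" by (cases u; cases v; cases w) auto
  show "u \<le> v \<Longrightarrow> v \<le> u \<Longrightarrow> u = v" by (cases u; cases v) auto
  show "u \<le> v \<or> v \<le> u" by (cases u; cases v) auto
qed

end

type_synonym 'k ratfun = "((indet \<Rightarrow>\<^sub>0 nat) \<Rightarrow>\<^sub>0 'k) fract"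

definition indet_fun :: "indet \<Rightarrow> 'k::field ratfun" where
  "indet_fun v = Fract (Poly_Mapping.single (Poly_Mapping.single v 1) 1) 1"

definition xvar :: "nat \<Rightarrow> 'k::field ratfun" where
  "xvar i = indet_fun (X_ind i)"

definition yvar :: "nat \<Rightarrow> 'k::field ratfun" where
  "yvar j = indet_fun (Y_ind j)"

lemma xvar_neq_yvar: "xvar i \<noteq> (yvar j :: 'k::field ratfun)"
proof -
  have ne: "Poly_Mapping.single (X_ind i) (1::nat) \<noteq> Poly_Mapping.single (Y_ind j) 1"
    by (metis indet.distinct(1) lookup_single_eq lookup_single_not_eq one_neq_zero)
  have "Poly_Mapping.single (Poly_Mapping.single (X_ind i) (1::nat)) (1::'k)
      \<noteq> Poly_Mapping.single (Poly_Mapping.single (Y_ind j) 1) 1"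
    by (metis ne lookup_single_eq lookup_single_not_eq one_neq_zero)
  then show ?thesis
    by (simp add: xvar_def yvar_def indet_fun_def eq_fract)
qed

type_synonym cell = "nat \<times> nat"

definition grid :: "nat \<Rightarrow> nat \<Rightarrow> cell set" where
  "grid m n = {1..m} \<times> {1..n}"

definition up_right :: "cell \<Rightarrow> cell \<Rightarrow> bool" where
  "up_right u v \<longleftrightarrow>
     (fst u = fst v + 1 \<and> snd v = snd u) \<or> (fst v = fst u \<and> snd v = snd u + 1)"

definition down_right :: "cell \<Rightarrow> cell \<Rightarrow> bool" where
  "down_right u v \<longleftrightarrow>
     (fst v = fst u + 1 \<and> snd v = snd u) \<or> (fst v = fst u \<and> snd v = snd u + 1)"

definition lattice_paths ::
  "cell set \<Rightarrow> (cell \<Rightarrow> cell \<Rightarrow> bool) \<Rightarrow> cell \<Rightarrow> cell \<Rightarrow> cell set set" where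
  "lattice_paths G step s t =
     {set cs | cs. cs \<noteq> [] \<and> hd cs = s \<and> last cs = t \<and> successively step cs \<and> set cs \<subseteq> G}"

text \<open>
  Tuples indexed by \<open>1, \<dots>, c\<close> are extensional functions on \<open>{1..c}\<close>, so that each
  tuple is counted exactly once.
\<close>

definition nonintersecting_tuples :: "nat \<Rightarrow> (nat \<Rightarrow> cell set set) \<Rightarrow> (nat \<Rightarrow> cell set) set" where
  "nonintersecting_tuples c P =
     {\<Gamma> \<in> (\<Pi>\<^sub>E p\<in>{1..c}. P p). disjoint_family_on \<Gamma> {1..c}}"

lemma finite_nonintersecting_tuples:
  "finite (nonintersecting_tuples c (\<lambda>p. lattice_paths (grid m n) step (s p) (t p)))"
proof -
  have "finite (lattice_paths (grid m n) step u v)" for u v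
    by (rule finite_subset[of _ "Pow (grid m n)"])
       (auto simp: lattice_paths_def grid_def)
  then show ?thesis
    unfolding nonintersecting_tuples_def by (intro finite_Collect_conjI disjI1) (simp add: finite_PiE)
qed

definition tuple_weight :: "nat \<Rightarrow> (nat \<Rightarrow> cell set) \<Rightarrow> 'k::field ratfun" where
  "tuple_weight c \<Gamma> = (\<Prod>(i, j)\<in>(\<Union>p\<in>{1..c}. \<Gamma> p). 1 / (xvar i - yvar j))"

end

theory Submission
  imports Defs
begin

text \<open>
  Flipping the rows turns the left side into the right side with \<open>x\<^sub>1, \<dots>, x\<^sub>m\<close> reversed
  (\<open>m = a + c\<close>, \<open>n = b + c\<close>), so it suffices that the right side is symmetric in the \<open>x\<^sub>i\<close>.
  The cells in two triangles, at the start points and at the end points, lie on every tuple.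
  Traversing them vertically instead of horizontally, the paths enter row \<open>1\<close> in columns
  \<open>1, \<dots>, c\<close> and leave row \<open>m\<close> in columns \<open>n - c + 1, \<dots>, n\<close>, so the sum is an entry of a product
  \<open>W(x\<^sub>1) \<cdots> W(x\<^sub>m)\<close> of row transfer matrices indexed by the columns in which the \<open>c\<close> paths cross from
  one row to the next. These matrices commute: for fixed entry and exit columns of two consecutive
  rows the sum factors over the paths, and each factor is symmetric in the two row variables by a
  telescoping argument.
\<close>

section \<open>Commuting row transfer matrices\<close>

text \<open>Path \<open>p\<close> enters a row in column \<open>k p\<close> and leaves it in column \<open>l p\<close>; the paths are numbered
  from right to left.\<close>

definition interlace :: "nat \<Rightarrow> (nat \<Rightarrow> nat) \<Rightarrow> (nat \<Rightarrow> nat) \<Rightarrow> bool" where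
  "interlace c k l \<longleftrightarrow> (\<forall>p\<in>{1..c}. k p \<le> l p) \<and> (\<forall>p\<in>{1..<c}. l (Suc p) < k p)"

text \<open>The entry at (\<open>k\<close>, \<open>l\<close>) of the transfer matrix of a row with
  variable \<open>x\<close>. The value 0 off \<open>interlace\<close> lets matrix products be
  written as sums over all of \<open>columns\<close>.\<close>

definition row_weight :: "nat \<Rightarrow> (nat \<Rightarrow> 'a::field) \<Rightarrow> 'a \<Rightarrow> (nat \<Rightarrow> nat) \<Rightarrow> (nat \<Rightarrow> nat) \<Rightarrow> 'a" where
  "row_weight c y x k l =
     (if interlace c k l then \<Prod>p\<in>{1..c}. \<Prod>j\<in>{k p..l p}. 1 / (x - y j) else 0)"

text \<open>Decrease along the tuple is not built in, because \<open>interlace\<close> forces it on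
  \<open>{1..c}\<close> for both of its arguments.\<close>

definition columns :: "nat \<Rightarrow> nat \<Rightarrow> (nat \<Rightarrow> nat) set" where
  "columns c n = (\<Pi>\<^sub>E p\<in>{1..c}. {1..n})"

lemma finite_columns [simp]: "finite (columns c n)"
  by (simp add: columns_def finite_PiE)

text \<open>Column \<open>l\<close> occurs in both products of its summand, so \<open>d\<close>
  turns \<open>f l * g l\<close> into \<open>f l - g l\<close> and the summand into a difference of
  consecutive mixed products, with \<open>f\<close> before the change point and \<open>g\<close>
  from it on. These differences telescope.\<close>

lemma two_row_sum_telescope:
  fixes f g :: "nat \<Rightarrow> 'a::comm_ring_1"
  assumes "\<And>l. d * (f l * g l) = f l - g l"
  shows "d * (\<Sum>l\<in>{A..<B}. (\<Prod>j\<in>{A..l}. f j) * (\<Prod>j\<in>{l..<B}. g j))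
       = (\<Prod>j\<in>{A..<B}. f j) - (\<Prod>j\<in>{A..<B}. g j)"
proof (induction B)
  case 0
  show ?case by simp
next
  case (Suc B)
  show ?case
  proof (cases "A \<le> B")
    case True
    let ?S = "\<Sum>l\<in>{A..<B}. (\<Prod>j\<in>{A..l}. f j) * (\<Prod>j\<in>{l..<B}. g j)"
    have "(\<Sum>l\<in>{A..<Suc B}. (\<Prod>j\<in>{A..l}. f j) * (\<Prod>j\<in>{l..<Suc B}. g j))
        = (\<Sum>l\<in>{A..<B}. (\<Prod>j\<in>{A..l}. f j) * (\<Prod>j\<in>{l..<Suc B}. g j)) + (\<Prod>j\<in>{A..B}. f j) * g B"
      using True by (simp add: prod.atLeastLessThan_Suc)
    also have "(\<Sum>l\<in>{A..<B}. (\<Prod>j\<in>{A..l}. f j) * (\<Prod>j\<in>{l..<Suc B}. g j)) = ?S * g B"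
      unfolding sum_distrib_right
      by (rule sum.cong) (auto simp: prod.atLeastLessThan_Suc mult.assoc)
    also have "(\<Prod>j\<in>{A..B}. f j) = (\<Prod>j\<in>{A..<B}. f j) * f B"
      using True by (simp flip: atLeastLessThanSuc_atLeastAtMost add: prod.atLeastLessThan_Suc)
    finally have *: "(\<Sum>l\<in>{A..<Suc B}. (\<Prod>j\<in>{A..l}. f j) * (\<Prod>j\<in>{l..<Suc B}. g j))
        = ?S * g B + (\<Prod>j\<in>{A..<B}. f j) * f B * g B" .
    \<comment> \<open>With \<open>F\<close> and \<open>G\<close> the products of \<open>f\<close>
      and \<open>g\<close> over \<open>{A..<B}\<close>, the induction hypothesis and the assumption
      on \<open>d\<close> yield
      \<open>(F - G) * g B + F * (f B - g B) = F * f B - G * g B\<close>.\<close>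
    have "d * (\<Sum>l\<in>{A..<Suc B}. (\<Prod>j\<in>{A..l}. f j) * (\<Prod>j\<in>{l..<Suc B}. g j))
        = d * ?S * g B + (\<Prod>j\<in>{A..<B}. f j) * (d * (f B * g B))"
      unfolding * by (simp add: algebra_simps)
    then show ?thesis
      unfolding Suc.IH assms using True by (simp add: algebra_simps prod.atLeastLessThan_Suc)
  qed simp
qed

text \<open>Telescoping with \<open>1 / (x - y j) - 1 / (x' - y j)\<close>, which is
  \<open>x' - x\<close> times the product of the two fractions, gives \<open>(x' - x) * ?S\<close>
  as a difference of one-row products. Exchanging \<open>x\<close> and \<open>x'\<close> changes the
  sign of both the factor and the difference.\<close>

lemma two_row_sum_symmetric:
  fixes y :: "nat \<Rightarrow> 'a::field"
  assumes "\<And>j. x \<noteq> y j" "\<And>j. x' \<noteq> y j"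
  shows "(\<Sum>l\<in>{A..<B}. (\<Prod>j\<in>{A..l}. 1 / (x - y j)) * (\<Prod>j\<in>{l..<B}. 1 / (x' - y j)))
       = (\<Sum>l\<in>{A..<B}. (\<Prod>j\<in>{A..l}. 1 / (x' - y j)) * (\<Prod>j\<in>{l..<B}. 1 / (x - y j)))"
    (is "?S = ?S'")
proof (cases "x = x'")
  case False
  have "(x' - x) * ?S = (\<Prod>j\<in>{A..<B}. 1 / (x - y j)) - (\<Prod>j\<in>{A..<B}. 1 / (x' - y j))"
    by (rule two_row_sum_telescope) (use assms in \<open>simp add: divide_simps\<close>)
  moreover have "(x - x') * ?S' = (\<Prod>j\<in>{A..<B}. 1 / (x' - y j)) - (\<Prod>j\<in>{A..<B}. 1 / (x - y j))"
    by (rule two_row_sum_telescope) (use assms in \<open>simp add: divide_simps\<close>)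
  ultimately have "(x' - x) * ?S = - ((x - x') * ?S')"
    by simp
  also have "\<dots> = (x' - x) * ?S'"
    by (simp flip: mult_minus_left)
  finally have "(x' - x) * ?S = (x' - x) * ?S'" .
  then show ?thesis using False by simp
qed simp

text \<open>Given the entry columns \<open>k\<close> and the exit columns \<open>l\<close> of two consecutive rows, path \<open>p\<close>
  may change rows at any column of an interval that does not depend on the other paths; outside
  these intervals the columns in use are occupied in both rows.\<close>

lemma row_weight_mult:
  fixes y :: "nat \<Rightarrow> 'a::field"
  assumes "k \<in> columns c n" "l \<in> columns c n"
  defines "A \<equiv> \<lambda>p. if p = c then k p else max (k p) (Suc (l (Suc p)))"
    and "B \<equiv> \<lambda>p. if p = 1 then Suc (l p) else min (Suc (l p)) (k (p - 1))"
  shows "(\<Sum>h\<in>columns c n. row_weight c y x k h * row_weight c y x' h l)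
    = (\<Prod>p\<in>{1..<c}. \<Prod>j\<in>{k p..l (Suc p)}. 1 / (x - y j) * (1 / (x' - y j)))
      * (\<Prod>p\<in>{1..c}. \<Sum>h\<in>{A p..<B p}. (\<Prod>j\<in>{A p..h}. 1 / (x - y j)) * (\<Prod>j\<in>{h..<B p}. 1 / (x' - y j)))"
proof -
  let ?f = "\<lambda>j. 1 / (x - y j)" and ?g = "\<lambda>j. 1 / (x' - y j)"
  let ?H = "\<Pi>\<^sub>E p\<in>{1..c}. {A p..<B p}"
  \<comment> \<open>The interval merges the bounds from the path itself with those from its
    neighbours. The leftmost path \<open>c\<close> has no left neighbour and the rightmost path
    \<open>1\<close> no right one, whence the case distinctions in \<open>A\<close> and
    \<open>B\<close>.\<close>
  have range: "h \<in> {A p..<B p} \<longleftrightarrow> k p \<le> h \<and> h \<le> l p \<and> (p < c \<longrightarrow> l (Suc p) < h) \<and> (p > 1 \<longrightarrow> h < k (p - 1))"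
    if "p \<in> {1..c}" for p h
    using that by (auto simp: A_def B_def)
  \<comment> \<open>The admissible crossing tuples form a box, so in the end
    \<open>prod_sum_PiE\<close> can exchange the sum over tuples with the product over
    paths.\<close>
  have H: "?H = {h \<in> columns c n. interlace c k h \<and> interlace c h l}"
  proof (intro equalityI subsetI)
    fix h assume h: "h \<in> ?H"
    then have r: "h p \<in> {A p..<B p}" if "p \<in> {1..c}" for p
      using that by (auto simp: PiE_iff)
    have "h \<in> columns c n"
    proof -
      have "h p \<in> {1..n}" if "p \<in> {1..c}" for p
      proof -
        have "k p \<ge> 1" "l p \<le> n" using assms(1,2) that by (auto simp: columns_def PiE_iff)
        then show ?thesis using r[OF that] unfolding range[OF that] by simp
      qed
      then show ?thesis using h by (auto simp: columns_def PiE_iff)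
    qed
    moreover have "h (Suc p) < k p" if "p \<in> {1..<c}" for p
      using r[of "Suc p"] range[of "Suc p" "h (Suc p)"] that by auto
    ultimately show "h \<in> {h \<in> columns c n. interlace c k h \<and> interlace c h l}"
      using r range by (auto simp: interlace_def)
  next
    fix h assume "h \<in> {h \<in> columns c n. interlace c k h \<and> interlace c h l}"
    then have h: "h \<in> columns c n" "interlace c k h" "interlace c h l" by auto
    have "h p \<in> {A p..<B p}" if p: "p \<in> {1..c}" for p
    proof -
      have "h p < k (p - 1)" if "p > 1"
      proof -
        have "p - 1 \<in> {1..<c}" "Suc (p - 1) = p" using p that by auto
        then show ?thesis using h(2) unfolding interlace_def by metis
      qed
      then show ?thesis using h p unfolding range[OF p] by (auto simp: interlace_def)
    qed
    then show "h \<in> ?H" using h(1) by (auto simp: PiE_iff columns_def)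
  qed
  \<comment> \<open>The cells of the first row before \<open>A p\<close> and those of the second row
    from \<open>B p\<close> on do not depend on \<open>h\<close> and are split off.\<close>
  have weight: "(\<Prod>p\<in>{1..c}. \<Prod>j\<in>{k p..h p}. ?f j) * (\<Prod>p\<in>{1..c}. \<Prod>j\<in>{h p..l p}. ?g j)
     = (\<Prod>p\<in>{1..<c}. \<Prod>j\<in>{k p..l (Suc p)}. ?f j * ?g j)
      * (\<Prod>p\<in>{1..c}. (\<Prod>j\<in>{A p..h p}. ?f j) * (\<Prod>j\<in>{h p..<B p}. ?g j))"
    if "h \<in> ?H" for h
  proof -
    have r: "h p \<in> {A p..<B p}" if "p \<in> {1..c}" for p
      using that \<open>h \<in> ?H\<close> by (auto simp: PiE_iff)
    have f: "(\<Prod>j\<in>{k p..h p}. ?f j) = (\<Prod>j\<in>{k p..<A p}. ?f j) * (\<Prod>j\<in>{A p..h p}. ?f j)"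
      if "p \<in> {1..c}" for p
    proof -
      have "{k p..h p} = {k p..<A p} \<union> {A p..h p}" using r[OF that] by (auto simp: A_def split: if_splits)
      then show ?thesis by (metis (no_types, lifting) finite_atLeastAtMost finite_atLeastLessThan 
            prod.union_disjoint ivl_disj_int_two(7))
    qed
    have g: "(\<Prod>j\<in>{h p..l p}. ?g j) = (\<Prod>j\<in>{h p..<B p}. ?g j) * (\<Prod>j\<in>{B p..l p}. ?g j)"
      if "p \<in> {1..c}" for p
    proof -
      have "{h p..l p} = {h p..<B p} \<union> {B p..l p}" using r[OF that] by (auto simp: B_def split: if_splits)
      then show ?thesis by (metis (no_types, lifting) finite_atLeastAtMost finite_atLeastLessThan 
            prod.union_disjoint ivl_disj_int_two(7))
    qed
    have f': "(\<Prod>p\<in>{1..c}. \<Prod>j\<in>{k p..<A p}. ?f j) = (\<Prod>p\<in>{1..<c}. \<Prod>j\<in>{k p..l (Suc p)}. ?f j)"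
    proof (rule prod.mono_neutral_cong_right)
      fix p assume "p \<in> {1..<c}"
      then have "{k p..<A p} = {k p..l (Suc p)}" by (auto simp: A_def)
      then show "(\<Prod>j\<in>{k p..<A p}. ?f j) = (\<Prod>j\<in>{k p..l (Suc p)}. ?f j)" by (rule arg_cong)
    qed (auto simp: A_def)
    \<comment> \<open>An index shift: the fixed cells of path \<open>p + 1\<close> in the second row
      occupy the same columns as those of path \<open>p\<close> in the first row, so the factors
      pair up as \<open>?f j * ?g j\<close>.\<close>
    have g': "(\<Prod>p\<in>{1..c}. \<Prod>j\<in>{B p..l p}. ?g j) = (\<Prod>p\<in>{1..<c}. \<Prod>j\<in>{k p..l (Suc p)}. ?g j)"
    proof -
      have "(\<Prod>p\<in>{1..c}. \<Prod>j\<in>{B p..l p}. ?g j) = (\<Prod>p\<in>Suc ` {1..<c}. \<Prod>j\<in>{B p..l p}. ?g j)"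
        by (rule prod.mono_neutral_right) (auto simp: B_def image_Suc_atLeastLessThan)
      also have "\<dots> = (\<Prod>p\<in>{1..<c}. \<Prod>j\<in>{B (Suc p)..l (Suc p)}. ?g j)"
        by (subst prod.reindex) simp_all
      also have "\<dots> = (\<Prod>p\<in>{1..<c}. \<Prod>j\<in>{k p..l (Suc p)}. ?g j)"
      proof (rule prod.cong[OF refl])
        fix p assume "p \<in> {1..<c}"
        then have "{B (Suc p)..l (Suc p)} = {k p..l (Suc p)}" by (auto simp: B_def)
        then show "(\<Prod>j\<in>{B (Suc p)..l (Suc p)}. ?g j) = (\<Prod>j\<in>{k p..l (Suc p)}. ?g j)" by (rule arg_cong)
      qed
      finally show ?thesis .
    qed
    have "(\<Prod>p\<in>{1..c}. \<Prod>j\<in>{k p..h p}. ?f j)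
        = (\<Prod>p\<in>{1..<c}. \<Prod>j\<in>{k p..l (Suc p)}. ?f j) * (\<Prod>p\<in>{1..c}. \<Prod>j\<in>{A p..h p}. ?f j)"
      unfolding f'[symmetric] prod.distrib[symmetric] by (rule prod.cong[OF refl]) (rule f)
    moreover have "(\<Prod>p\<in>{1..c}. \<Prod>j\<in>{h p..l p}. ?g j)
        = (\<Prod>p\<in>{1..c}. \<Prod>j\<in>{h p..<B p}. ?g j) * (\<Prod>p\<in>{1..<c}. \<Prod>j\<in>{k p..l (Suc p)}. ?g j)"
      unfolding g'[symmetric] prod.distrib[symmetric] by (rule prod.cong[OF refl]) (rule g)
    ultimately show ?thesis
      by (simp only: prod.distrib mult.assoc mult.commute mult.left_commute)
  qed
  have "(\<Sum>h\<in>columns c n. row_weight c y x k h * row_weight c y x' h l)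
     = (\<Sum>h\<in>?H. row_weight c y x k h * row_weight c y x' h l)"
    unfolding H by (rule sum.mono_neutral_right) (auto simp: row_weight_def)
  also have "\<dots> = (\<Sum>h\<in>?H. (\<Prod>p\<in>{1..c}. \<Prod>j\<in>{k p..h p}. ?f j) * (\<Prod>p\<in>{1..c}. \<Prod>j\<in>{h p..l p}. ?g j))"
    by (rule sum.cong[OF refl]) (unfold H, simp add: row_weight_def)
  also have "\<dots> = (\<Prod>p\<in>{1..<c}. \<Prod>j\<in>{k p..l (Suc p)}. ?f j * ?g j)
      * (\<Sum>h\<in>?H. \<Prod>p\<in>{1..c}. (\<Prod>j\<in>{A p..h p}. ?f j) * (\<Prod>j\<in>{h p..<B p}. ?g j))"
    unfolding sum_distrib_left by (rule sum.cong[OF refl]) (rule weight)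
  finally show ?thesis
    by (simp add: prod_sum_PiE)
qed

text \<open>In the factored form the fixed cells contribute symmetrically, and since
  \<open>A\<close> and \<open>B\<close> do not involve the row variables, each path's sum is
  symmetric by \<open>two_row_sum_symmetric\<close>.\<close>

lemma row_weight_commute:
  fixes y :: "nat \<Rightarrow> 'a::field"
  assumes "k \<in> columns c n" "l \<in> columns c n" "\<And>j. x \<noteq> y j" "\<And>j. x' \<noteq> y j"
  shows "(\<Sum>h\<in>columns c n. row_weight c y x k h * row_weight c y x' h l)
    = (\<Sum>h\<in>columns c n. row_weight c y x' k h * row_weight c y x h l)"
  unfolding row_weight_mult[OF assms(1,2)] two_row_sum_symmetric[OF assms(3,4)]
  by (simp add: mult.commute)

section \<open>Products of row transfer matrices and their expansion into chains\<close>

fun transfer :: "nat \<Rightarrow> nat \<Rightarrow> (nat \<Rightarrow> 'a::field) \<Rightarrow> 'a list \<Rightarrow> (nat \<Rightarrow> nat) \<Rightarrow> (nat \<Rightarrow> nat) \<Rightarrow> 'a" where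
  "transfer c n y [] k l = of_bool (k = l)"
| "transfer c n y (x # xs) k l = (\<Sum>h\<in>columns c n. row_weight c y x k h * transfer c n y xs h l)"

text \<open>Associativity of the matrix product. The recursion peels off the first row, whereas the
  induction on the number of rows in \<open>transfer_eq_sum_chains\<close> appends a last
  one.\<close>

lemma transfer_snoc:
  assumes "k \<in> columns c n" "l \<in> columns c n"
  shows "transfer c n y (xs @ [x]) k l
       = (\<Sum>h\<in>columns c n. transfer c n y xs k h * row_weight c y x h l)"
  using assms(1)
proof (induction xs arbitrary: k)
  case Nil
  then show ?case using assms(2) by (simp add: of_bool_def if_distrib[of "\<lambda>z. _ * z"] if_distrib[of "\<lambda>z. z * _"] cong: if_cong)
next
  case (Cons z xs)
  have "transfer c n y ((z # xs) @ [x]) k l = (\<Sum>h\<in>columns c n. row_weight c y z k h *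
      (\<Sum>h'\<in>columns c n. transfer c n y xs h h' * row_weight c y x h' l))"
    using Cons.IH by simp
  also have "\<dots> = (\<Sum>h'\<in>columns c n. \<Sum>h\<in>columns c n. row_weight c y z k h * transfer c n y xs h h' * row_weight c y x h' l)"
    unfolding sum_distrib_left by (subst sum.swap) (simp add: mult.assoc)
  finally show ?case by (simp add: sum_distrib_right)
qed

text \<open>The induction hypothesis moves \<open>x\<close> to the front of the tail; one exchange
  of adjacent matrices by \<open>row_weight_commute\<close> then moves it past the head.\<close>

lemma transfer_rotate:
  assumes "k \<in> columns c n" "l \<in> columns c n" "\<And>z j. z \<in> set (x # xs) \<Longrightarrow> z \<noteq> y j"
  shows "transfer c n y (xs @ [x]) k l = transfer c n y (x # xs) k l"
  using assms(1,3)
proof (induction xs arbitrary: k)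
  case (Cons z xs)
  let ?C = "columns c n"
  have "transfer c n y ((z # xs) @ [x]) k l = (\<Sum>h\<in>?C. row_weight c y z k h * transfer c n y (x # xs) h l)"
    unfolding append_Cons transfer.simps(2)[of c n y z]
    using Cons.prems(2) by (intro sum.cong arg_cong2[where f = "(*)"] refl Cons.IH) auto
  also have "\<dots> = (\<Sum>h\<in>?C. \<Sum>h'\<in>?C. row_weight c y z k h * row_weight c y x h h' * transfer c n y xs h' l)"
    by (simp add: sum_distrib_left mult.assoc)
  also have "\<dots> = (\<Sum>h'\<in>?C. (\<Sum>h\<in>?C. row_weight c y z k h * row_weight c y x h h') * transfer c n y xs h' l)"
    by (subst sum.swap) (simp add: sum_distrib_right)
  also have "\<dots> = (\<Sum>h'\<in>?C. (\<Sum>h\<in>?C. row_weight c y x k h * row_weight c y z h h') * transfer c n y xs h' l)"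
    using Cons.prems by (intro sum.cong arg_cong2[where f = "(*)"] refl row_weight_commute) auto
  also have "\<dots> = (\<Sum>h\<in>?C. \<Sum>h'\<in>?C. row_weight c y x k h * row_weight c y z h h' * transfer c n y xs h' l)"
    by (subst sum.swap) (simp add: sum_distrib_right)
  finally show ?case by (simp add: sum_distrib_left mult.assoc)
qed simp

text \<open>Reversal is a sequence of rotations: \<open>rev (x # xs)\<close> ends in
  \<open>x\<close>, which \<open>transfer_rotate\<close> brings to the front.\<close>

lemma transfer_rev:
  assumes "k \<in> columns c n" "l \<in> columns c n" "\<And>z j. z \<in> set xs \<Longrightarrow> z \<noteq> y j"
  shows "transfer c n y (rev xs) k l = transfer c n y xs k l"
  using assms(1,3)
proof (induction xs arbitrary: k)
  case (Cons x xs)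
  have "transfer c n y (rev (x # xs)) k l = transfer c n y (x # rev xs) k l"
    using Cons.prems assms(2) by (simp only: rev.simps) (rule transfer_rotate; auto)
  then show ?case using Cons by simp
qed simp

text \<open>Here \<open>\<kappa> i p\<close> is the column in which path \<open>p\<close> crosses
  from row \<open>i\<close> to row \<open>i + 1\<close>; the indices \<open>0\<close> and
  \<open>m\<close> stand for entering row \<open>1\<close> and leaving row \<open>m\<close>.\<close>

definition column_chains :: "nat \<Rightarrow> nat \<Rightarrow> nat \<Rightarrow> (nat \<Rightarrow> nat) \<Rightarrow> (nat \<Rightarrow> nat) \<Rightarrow> (nat \<Rightarrow> nat \<Rightarrow> nat) set" where
  "column_chains c n m k l = {\<kappa> \<in> (\<Pi>\<^sub>E i\<in>{0..m}. columns c n).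
     \<kappa> 0 = k \<and> \<kappa> m = l \<and> (\<forall>i<m. interlace c (\<kappa> i) (\<kappa> (Suc i)))}"

lemma finite_column_chains [simp]: "finite (column_chains c n m k l)"
  unfolding column_chains_def by (intro finite_Collect_conjI disjI1) (simp add: finite_PiE)

lemma column_chains_Suc:
  assumes "l \<in> columns c n"
  shows "column_chains c n (Suc m) k l
       = (\<lambda>\<kappa>. \<kappa>(Suc m := l)) ` (\<Union>h\<in>{h\<in>columns c n. interlace c h l}. column_chains c n m k h)"
    (is "?L = ?R")
proof (intro equalityI subsetI)
  fix \<kappa> assume \<kappa>: "\<kappa> \<in> ?L"
  let ?\<mu> = "restrict \<kappa> {0..m}"
  have "\<kappa> = ?\<mu>(Suc m := l)"
    using \<kappa> by (auto simp: column_chains_def PiE_iff extensional_def fun_eq_iff)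
  moreover have "?\<mu> \<in> column_chains c n m k (\<kappa> m)" "\<kappa> m \<in> columns c n" "interlace c (\<kappa> m) l"
    using \<kappa> by (auto simp: column_chains_def PiE_iff)
  ultimately show "\<kappa> \<in> ?R" by blast
next
  fix \<kappa> assume "\<kappa> \<in> ?R"
  then obtain h \<mu> where h: "h \<in> columns c n" "interlace c h l" "\<mu> \<in> column_chains c n m k h" "\<kappa> = \<mu>(Suc m := l)"
    by blast
  then show "\<kappa> \<in> ?L"
    using assms by (auto simp: column_chains_def PiE_iff extensional_def less_Suc_eq)
qed

text \<open>Expanding the matrix product gives a sum over sequences of index tuples, in which only
  the interlacing sequences survive.\<close>

lemma transfer_eq_sum_chains:
  fixes y X :: "nat \<Rightarrow> 'a::field"
  assumes "k \<in> columns c n" "l \<in> columns c n"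
  shows "transfer c n y (map X [1..<Suc m]) k l
       = (\<Sum>\<kappa>\<in>column_chains c n m k l. \<Prod>i<m. \<Prod>p\<in>{1..c}. \<Prod>j\<in>{\<kappa> i p..\<kappa> (Suc i) p}. 1 / (X (Suc i) - y j))"
  using assms(2)
proof (induction m arbitrary: l)
  case 0
  have "column_chains c n 0 k l = (if k = l then {\<lambda>i\<in>{0}. k} else {})"
    using assms(1) by (auto simp: column_chains_def PiE_iff extensional_def fun_eq_iff)
  then show ?case by simp
next
  case (Suc m)
  let ?w = "\<lambda>m \<kappa>. \<Prod>i<m. \<Prod>p\<in>{1..c}. \<Prod>j\<in>{\<kappa> i p..\<kappa> (Suc i) p}. 1 / (X (Suc i) - y j)"
  let ?f = "\<lambda>h. \<Prod>p\<in>{1..c}. \<Prod>j\<in>{h p..l p}. 1 / (X (Suc m) - y j)"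
  let ?I = "{h \<in> columns c n. interlace c h l}"
  have inj: "inj_on (\<lambda>\<kappa>. \<kappa>(Suc m := l)) (\<Union>h\<in>?I. column_chains c n m k h)"
  proof (rule inj_onI)
    fix \<kappa> \<mu> assume *: "\<kappa> \<in> (\<Union>h\<in>?I. column_chains c n m k h)" "\<mu> \<in> (\<Union>h\<in>?I. column_chains c n m k h)"
      and eq: "\<kappa>(Suc m := l) = \<mu>(Suc m := l)"
    \<comment> \<open>Both chains are extensional on \<open>{0..m}\<close>, so the value overwritten
      at \<open>Suc m\<close> is known and the update can be undone.\<close>
    have "\<kappa> (Suc m) = undefined" "\<mu> (Suc m) = undefined"
      using * by (auto simp: column_chains_def PiE_iff extensional_def)
    with eq show "\<kappa> = \<mu>" by (metis fun_upd_triv fun_upd_upd)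
  qed
  have w: "?w (Suc m) (\<kappa>(Suc m := l)) = ?w m \<kappa> * ?f h" if "\<kappa> \<in> column_chains c n m k h" for \<kappa> h
    using that by (simp add: column_chains_def)
  have "(\<Sum>\<kappa>\<in>column_chains c n (Suc m) k l. ?w (Suc m) \<kappa>)
      = (\<Sum>\<kappa>\<in>(\<Union>h\<in>?I. column_chains c n m k h). ?w (Suc m) (\<kappa>(Suc m := l)))"
    unfolding column_chains_Suc[OF Suc.prems] by (subst sum.reindex[OF inj]) simp
  also have "\<dots> = (\<Sum>h\<in>?I. \<Sum>\<kappa>\<in>column_chains c n m k h. ?w (Suc m) (\<kappa>(Suc m := l)))"
    by (rule sum.UNION_disjoint) (simp_all, auto simp: column_chains_def)
  also have "\<dots> = (\<Sum>h\<in>?I. transfer c n y (map X [1..<Suc m]) k h * ?f h)"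
    by (intro sum.cong refl) (simp only: Suc.IH sum_distrib_right mem_Collect_eq, rule sum.cong[OF refl], erule w)
  also have "\<dots> = (\<Sum>h\<in>columns c n. transfer c n y (map X [1..<Suc m]) k h * row_weight c y (X (Suc m)) h l)"
    by (rule sum.mono_neutral_cong_left) (auto simp: row_weight_def)
  also have "\<dots> = transfer c n y (map X [1..<Suc (Suc m)]) k l"
    using transfer_snoc[OF assms(1) Suc.prems, of y "map X [1..<Suc m]" "X (Suc m)"] by simp
  finally show ?case by simp
qed

section \<open>Staircase description of lattice paths\<close>

text \<open>The indexing matches \<open>column_chains\<close>: \<open>t i\<close> is the column in
  which row \<open>i\<close> is left, so the path occupies rows \<open>r + 1\<close> to
  \<open>s\<close> and starts in column \<open>t r\<close>.\<close>

definition stair :: "(nat \<Rightarrow> nat) \<Rightarrow> nat \<Rightarrow> nat \<Rightarrow> cell set" where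
  "stair t r s = {(i, j). r < i \<and> i \<le> s \<and> t (i - 1) \<le> j \<and> j \<le> t i}"

lemma stair_cong:
  assumes "\<And>i. i \<in> {r..s} \<Longrightarrow> t i = t' i"
  shows "stair t r s = stair t' r s"
proof -
  have "t i = t' i \<and> t (i - 1) = t' (i - 1)" if "r < i" "i \<le> s" for i
    using that by (auto intro!: assms)
  then show ?thesis by (auto simp: stair_def)
qed

lemma down_right_path_stair:
  assumes "cs \<noteq> []" "successively down_right cs" "hd cs = (Suc r, u)" "last cs = (s, v)"
  shows "\<exists>t. r < s \<and> mono_on {r..s} t \<and> t r = u \<and> t s = v \<and> set cs = stair t r s"
  using assms
proof (induction cs arbitrary: r u rule: list_nonempty_induct)
  case (single z)
  then have "s = Suc r" "v = u" "z = (Suc r, u)" by auto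
  then show ?case
    by (intro exI[of _ "\<lambda>_. u"]) (auto simp: stair_def mono_on_def)
next
  case (cons z cs)
  then have z: "z = (Suc r, u)" and step: "down_right (Suc r, u) (hd cs)"
    and cs: "successively down_right cs" "last cs = (s, v)"
    by (auto simp: successively_Cons)
  from step consider "hd cs = (Suc (Suc r), u)" | "hd cs = (Suc r, Suc u)"
    by (cases "hd cs") (auto simp: down_right_def)
  then show ?case
  proof cases
    \<comment> \<open>A first step down leaves row \<open>Suc r\<close> with the single cell in
      column \<open>u\<close>; this is recorded by the new value \<open>t r = u\<close>.\<close>
    case 1
    from cons.IH[OF cs(1) 1 cs(2)] obtain t where
      t: "Suc r < s" "mono_on {Suc r..s} t" "t (Suc r) = u" "t s = v" "set cs = stair t (Suc r) s"
      by blast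
    have "mono_on {r..s} (t(r := u))"
    proof (rule mono_onI)
      fix i j assume ij: "i \<in> {r..s}" "j \<in> {r..s}" "i \<le> j"
      have "u \<le> t j" if "r < j"
        using mono_onD[OF t(2), of "Suc r" j] t(3) that ij by auto
      then show "(t(r := u)) i \<le> (t(r := u)) j"
        using mono_onD[OF t(2), of i j] ij by auto
    qed
    moreover have "x \<in> set (z # cs) \<longleftrightarrow> x \<in> stair (t(r := u)) r s" for x
    proof (cases x)
      case (Pair i j)
      then show ?thesis
        using t(1,3) unfolding list.set t(5) z stair_def by (cases "i = Suc r") auto
    qed
    ultimately show ?thesis
      using t by (intro exI[of _ "t(r := u)"]) (auto simp del: fun_upd_apply list.set simp add: fun_upd_same fun_upd_other)
  next
    \<comment> \<open>A first step to the right extends row \<open>Suc r\<close> by one cell on the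
      left, so \<open>t r\<close> drops from \<open>Suc u\<close> to \<open>u\<close>.\<close>
    case 2
    from cons.IH[OF cs(1) 2 cs(2)] obtain t where
      t: "r < s" "mono_on {r..s} t" "t r = Suc u" "t s = v" "set cs = stair t r s"
      by blast
    have "mono_on {r..s} (t(r := u))"
    proof (rule mono_onI)
      fix i j assume ij: "i \<in> {r..s}" "j \<in> {r..s}" "i \<le> j"
      have "u \<le> t j"
        using mono_onD[OF t(2), of r j] t(3) ij by auto
      then show "(t(r := u)) i \<le> (t(r := u)) j"
        using mono_onD[OF t(2), of i j] ij by auto
    qed
    moreover have "u \<le> t (Suc r)"
      using mono_onD[OF t(2), of r "Suc r"] t(1,3) by auto
    then have "set (z # cs) = stair (t(r := u)) r s"
      using t(1,3) unfolding list.set t(5) z stair_def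
      by (auto simp: le_Suc_eq Suc_le_eq split: if_splits)
    ultimately show ?thesis
      using t by (intro exI[of _ "t(r := u)"]) (auto simp del: fun_upd_apply list.set simp add: fun_upd_same fun_upd_other)
  qed
qed

text \<open>The rows are concatenated. Row \<open>Suc s\<close> begins in column \<open>t s\<close>,
  where row \<open>s\<close> ends, so the junction is a step down.\<close>

lemma stair_down_right_path:
  assumes "r < s" "mono_on {r..s} t"
  shows "\<exists>cs. cs \<noteq> [] \<and> successively down_right cs \<and> hd cs = (Suc r, t r) \<and> last cs = (s, t s) \<and>
    set cs = stair t r s"
  using assms
proof (induction s)
  case (Suc s)
  define row where "row = map (Pair (Suc s)) [t s..<Suc (t (Suc s))]"
  have le: "t s \<le> t (Suc s)" using Suc.prems by (intro mono_onD[OF Suc.prems(2)]) auto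
  have row: "row \<noteq> []" "hd row = (Suc s, t s)" "last row = (Suc s, t (Suc s))"
    "set row = {Suc s} \<times> {t s..t (Suc s)}"
    using le by (auto simp: row_def hd_map last_map simp del: upt_Suc)
  have succ: "successively down_right row"
    by (auto simp: row_def successively_map successively_conv_nth down_right_def simp del: upt_Suc)
  show ?case
  proof (cases "r = s")
    case True
    then have "set row = stair t r (Suc s)" unfolding row stair_def by (auto simp: le_Suc_eq)
    then show ?thesis using row succ True by blast
  next
    case False
    then have "r < s" using Suc.prems by simp
    moreover have "mono_on {r..s} t" using Suc.prems(2) by (rule mono_on_subset) auto
    ultimately obtain cs where cs: "cs \<noteq> []" "successively down_right cs" "hd cs = (Suc r, t r)"
      "last cs = (s, t s)" "set cs = stair t r s"
      using Suc.IH by blast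
    have "set (cs @ row) = stair t r (Suc s)"
      using \<open>r < s\<close> unfolding set_append row cs stair_def by (auto simp: le_Suc_eq)
    moreover have "successively down_right (cs @ row)"
      using cs row succ by (auto simp: successively_append_iff down_right_def)
    ultimately show ?thesis using cs row by (intro exI[of _ "cs @ row"]) auto
  qed
qed simp

lemma stair_subset_grid:
  assumes "s \<le> m" "mono_on {r..s} t" "1 \<le> t r" "t s \<le> n"
  shows "stair t r s \<subseteq> grid m n"
proof
  fix z assume "z \<in> stair t r s"
  then obtain i j where z: "z = (i, j)" "r < i" "i \<le> s" "t (i - 1) \<le> j" "j \<le> t i"
    by (auto simp: stair_def)
  have "t r \<le> t (i - 1)" "t i \<le> t s"
    using z by (auto intro!: mono_onD[OF assms(2)])
  then show "z \<in> grid m n" using z assms by (auto simp: grid_def)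
qed

lemma lattice_paths_down_right:
  assumes "s \<le> m" "1 \<le> u" "v \<le> n"
  shows "lattice_paths (grid m n) down_right (Suc r, u) (s, v)
    = {stair t r s | t. r < s \<and> mono_on {r..s} t \<and> t r = u \<and> t s = v}"
proof (intro equalityI subsetI)
  fix P assume "P \<in> lattice_paths (grid m n) down_right (Suc r, u) (s, v)"
  then show "P \<in> {stair t r s | t. r < s \<and> mono_on {r..s} t \<and> t r = u \<and> t s = v}"
    using down_right_path_stair unfolding lattice_paths_def by fastforce
next
  fix P assume "P \<in> {stair t r s | t. r < s \<and> mono_on {r..s} t \<and> t r = u \<and> t s = v}"
  then obtain t where t: "P = stair t r s" "r < s" "mono_on {r..s} t" "t r = u" "t s = v" by blast
  then show "P \<in> lattice_paths (grid m n) down_right (Suc r, u) (s, v)"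
    using stair_down_right_path[OF t(2,3)] stair_subset_grid[of s m r t n] assms
    unfolding lattice_paths_def by auto
qed

text \<open>By monotonicity \<open>(i, t i)\<close> is a cell of the stair, the last one in row
  \<open>i\<close>; equality of the stairs then bounds \<open>t i\<close> and \<open>t' i\<close> by
  each other.\<close>

lemma stair_inject:
  assumes "stair t r s = stair t' r s" "mono_on {r..s} t" "mono_on {r..s} t'" "r < i" "i \<le> s"
  shows "t i = t' i"
proof -
  have "t (i - 1) \<le> t i" "t' (i - 1) \<le> t' i"
    using assms(4,5) by (auto intro!: mono_onD[OF assms(2)] mono_onD[OF assms(3)])
  then have "(i, t i) \<in> stair t r s" "(i, t' i) \<in> stair t' r s"
    using assms(4,5) by (auto simp: stair_def)
  then show ?thesis using assms(1) by (auto simp: stair_def intro: antisym)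
qed

section \<open>Path tuples and chains of crossing columns\<close>

text \<open>Comparisons of neighbours chain through \<open>l (Suc q) < k q \<le> l q\<close>. This
  separates any two paths within a row.\<close>

lemma interlace_less:
  assumes "interlace c k l" "1 \<le> p" "p < q" "q \<le> c"
  shows "l q < k p"
proof -
  have "Suc p \<le> q" using assms(3) by simp
  then show ?thesis using assms(4)
  proof (induction q rule: dec_induct)
    case base
    then show ?case using assms(1,2) by (auto simp: interlace_def)
  next
    case (step q)
    then have "l (Suc q) < k q" "k q \<le> l q" "l q < k p"
      using assms(1,2) by (auto simp: interlace_def)
    then show ?case by simp
  qed
qed

lemma tuple_subset_grid:
  assumes "\<Gamma> \<in> nonintersecting_tuples c (\<lambda>p. lattice_paths G step (s p) (t p))" "p \<in> {1..c}"
  shows "\<Gamma> p \<subseteq> G"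
proof -
  have "\<Gamma> p \<in> lattice_paths G step (s p) (t p)"
    using assms by (auto simp: nonintersecting_tuples_def)
  then show ?thesis by (auto simp: lattice_paths_def)
qed

locale path_grid =
  fixes a c m n :: nat
  assumes m: "m = a + c" and n: "c \<le> n"
begin

definition start_columns :: "nat \<Rightarrow> nat" where
  "start_columns = (\<lambda>p\<in>{1..c}. c + 1 - p)"

definition end_columns :: "nat \<Rightarrow> nat" where
  "end_columns = (\<lambda>p\<in>{1..c}. n + 1 - p)"

abbreviation configs :: "(nat \<Rightarrow> nat \<Rightarrow> nat) set" where
  "configs \<equiv> column_chains c n m start_columns end_columns"

abbreviation path_tuples :: "(nat \<Rightarrow> cell set) set" where
  "path_tuples \<equiv> nonintersecting_tuples c (\<lambda>p. lattice_paths (grid m n) down_right (p, 1) (a + p, n))"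

text \<open>Undoes the vertical traversal of the two triangles: path \<open>p\<close> of the tuple lives in rows
  \<open>p, \<dots>, a + p\<close> only, starts in column \<open>1\<close> and ends in column \<open>n\<close>.\<close>

definition leave :: "(nat \<Rightarrow> nat \<Rightarrow> nat) \<Rightarrow> nat \<Rightarrow> nat \<Rightarrow> nat" where
  "leave \<kappa> p i = (if i < p then 1 else if a + p \<le> i then n else \<kappa> i p)"

definition paths_of :: "(nat \<Rightarrow> nat \<Rightarrow> nat) \<Rightarrow> nat \<Rightarrow> cell set" where
  "paths_of \<kappa> = (\<lambda>p\<in>{1..c}. stair (leave \<kappa> p) (p - 1) (a + p))"

lemma start_columns_mem: "start_columns \<in> columns c n"
  and end_columns_mem: "end_columns \<in> columns c n"
  using n by (auto simp: start_columns_def end_columns_def columns_def)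

lemma config_interlace: "\<kappa> \<in> configs \<Longrightarrow> i < m \<Longrightarrow> interlace c (\<kappa> i) (\<kappa> (Suc i))"
  by (simp add: column_chains_def)

lemma config_mono:
  assumes "\<kappa> \<in> configs" "p \<in> {1..c}" "i \<le> j" "j \<le> m"
  shows "\<kappa> i p \<le> \<kappa> j p"
  using assms(3,4)
proof (induction j rule: dec_induct)
  case (step k)
  then have "interlace c (\<kappa> k) (\<kappa> (Suc k))" by (intro config_interlace assms) simp
  then have "\<kappa> k p \<le> \<kappa> (Suc k) p" using assms(2) by (simp add: interlace_def)
  then show ?case using step by simp
qed simp

lemma config_bounds:
  assumes "\<kappa> \<in> configs" "p \<in> {1..c}" "i \<le> m"
  shows "c + 1 - p \<le> \<kappa> i p" "\<kappa> i p \<le> n + 1 - p"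
proof -
  have "\<kappa> 0 = start_columns" "\<kappa> m = end_columns"
    using assms(1) by (auto simp: column_chains_def)
  then show "c + 1 - p \<le> \<kappa> i p" "\<kappa> i p \<le> n + 1 - p"
    using config_mono[OF assms(1,2), of 0 i] config_mono[OF assms(1,2), of i m] assms(2,3)
    by (auto simp: start_columns_def end_columns_def)
qed

text \<open>Crossing \<open>i + 1\<close> of path \<open>p\<close> lies strictly left of crossing
  \<open>i\<close> of path \<open>p - 1\<close>, so the start columns push the upper bound down to
  the lower bound of \<open>config_bounds\<close>.\<close>

lemma config_frozen_start:
  assumes "\<kappa> \<in> configs" "p \<in> {1..c}" "i < p" "i \<le> m"
  shows "\<kappa> i p = c + 1 - p"
proof -
  have "\<kappa> i p \<le> c + 1 - p"
    using assms(2-4)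
  proof (induction i arbitrary: p)
    case 0
    then show ?case using assms(1) by (auto simp: column_chains_def start_columns_def)
  next
    case (Suc i)
    then obtain q where q: "p = Suc q" "q \<in> {1..<c}" "i < q" by (cases p) auto
    then have "\<kappa> (Suc i) p < \<kappa> i q" using config_interlace[OF assms(1), of i] Suc.prems
      by (auto simp: interlace_def)
    moreover have "\<kappa> i q \<le> c + 1 - q" using q Suc.prems by (intro Suc.IH) auto
    ultimately show ?case using q by simp
  qed
  then show ?thesis using config_bounds[OF assms(1,2,4)] by simp
qed

text \<open>The mirror image at the last row: going back from \<open>m\<close>, crossing
  \<open>i\<close> of path \<open>p\<close> lies strictly right of crossing \<open>i + 1\<close> of
  path \<open>p + 1\<close>.\<close>

lemma config_frozen_end:
  assumes "\<kappa> \<in> configs" "p \<in> {1..c}" "a + p \<le> i" "i \<le> m"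
  shows "\<kappa> i p = n + 1 - p"
proof -
  have "n + 1 - p \<le> \<kappa> i p"
    using assms(4,2,3)
  proof (induction i arbitrary: p rule: inc_induct)
    case base
    then show ?case using assms(1) by (auto simp: column_chains_def end_columns_def)
  next
    case (step i)
    then have "p \<in> {1..<c}" by (auto simp: m)
    then have "\<kappa> (Suc i) (Suc p) < \<kappa> i p" using config_interlace[OF assms(1), of i] step
      by (auto simp: interlace_def)
    moreover have "n + 1 - Suc p \<le> \<kappa> (Suc i) (Suc p)"
      using step \<open>p \<in> {1..<c}\<close> by (intro step.IH) auto
    ultimately show ?case using \<open>p \<in> {1..<c}\<close> n by simp
  qed
  then show ?thesis using config_bounds[OF assms(1,2,4)] by simp
qed

lemma mono_on_leave:
  assumes "\<kappa> \<in> configs" "p \<in> {1..c}"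
  shows "mono_on {p - 1..a + p} (leave \<kappa> p)"
proof (rule mono_onI)
  fix i j assume ij: "i \<in> {p - 1..a + p}" "j \<in> {p - 1..a + p}" "i \<le> j"
  then have "i \<le> m" "j \<le> m" using assms(2) by (auto simp: m)
  then show "leave \<kappa> p i \<le> leave \<kappa> p j"
    using config_mono[OF assms, of i j] config_bounds[OF assms, of i] config_bounds[OF assms, of j] assms(2) ij n
    by (auto simp: leave_def)
qed

lemma paths_of_mem:
  assumes "\<kappa> \<in> configs"
  shows "paths_of \<kappa> \<in> path_tuples"
proof -
  have "paths_of \<kappa> p \<in> lattice_paths (grid m n) down_right (p, 1) (a + p, n)" if "p \<in> {1..c}" for p
  proof -
    have "leave \<kappa> p (p - 1) = 1" "leave \<kappa> p (a + p) = n" using that by (auto simp: leave_def)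
    moreover have "Suc (p - 1) = p" "a + p \<le> m" "p - 1 < a + p" using that by (auto simp: m)
    ultimately show ?thesis
      using lattice_paths_down_right[of "a + p" m 1 n n "p - 1"] mono_on_leave[OF assms that] that
      by (auto simp: paths_of_def)
  qed
  moreover have False if pq: "p \<in> {1..c}" "q \<in> {1..c}" "p < q" "z \<in> paths_of \<kappa> p" "z \<in> paths_of \<kappa> q" for p q z
  proof -
    obtain i j where z: "z = (Suc i, j)" "q \<le> Suc i" "i < a + p" "leave \<kappa> p i \<le> j" "j \<le> leave \<kappa> q (Suc i)"
    proof (cases z)
      case (Pair i j)
      then show ?thesis using that pq
        by (cases i) (auto simp: paths_of_def stair_def)
    qed
    \<comment> \<open>In a row shared by both paths neither exceptional value in
      \<open>leave\<close> applies to these two crossings, so the inequality contradicts the bounds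
      on \<open>j\<close>.\<close>
    have "\<kappa> (Suc i) q < \<kappa> i p"
      using z pq by (intro interlace_less[OF config_interlace[OF assms]]) (auto simp: m)
    then show False using z pq by (auto simp: leave_def split: if_splits)
  qed
  then have "disjoint_family_on (paths_of \<kappa>) {1..c}"
    unfolding disjoint_family_on_def by (metis disjoint_iff linorder_neqE_nat)
  ultimately show ?thesis
    by (auto simp: nonintersecting_tuples_def PiE_iff paths_of_def)
qed

text \<open>For \<open>p \<le> i < a + p\<close> the crossing \<open>\<kappa> i p\<close> is read
  off the stair; all other crossings are frozen.\<close>

lemma inj_on_paths_of: "inj_on paths_of configs"
proof (rule inj_onI)
  fix \<kappa> \<mu> assume \<kappa>: "\<kappa> \<in> configs" and \<mu>: "\<mu> \<in> configs" and eq: "paths_of \<kappa> = paths_of \<mu>"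
  have pi: "\<kappa> i p = \<mu> i p" if "i \<le> m" "p \<in> {1..c}" for i p
  proof -
    consider "i < p" | "p \<le> i" "i < a + p" | "a + p \<le> i" by linarith
    then show ?thesis
    proof cases
      case 1
      then show ?thesis using config_frozen_start[OF \<kappa>, of p i] config_frozen_start[OF \<mu>, of p i] that by simp
    next
      case 2
      have "stair (leave \<kappa> p) (p - 1) (a + p) = stair (leave \<mu> p) (p - 1) (a + p)"
        using fun_cong[OF eq, of p] that by (simp add: paths_of_def)
      then have "leave \<kappa> p i = leave \<mu> p i"
        by (rule stair_inject) (use mono_on_leave \<kappa> \<mu> that 2 in auto)
      then show ?thesis using 2 by (simp add: leave_def)
    next
      case 3
      then show ?thesis using config_frozen_end[OF \<kappa>, of p i] config_frozen_end[OF \<mu>, of p i] that by simp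
    qed
  qed
  have mem: "\<kappa> \<in> {0..m} \<rightarrow>\<^sub>E columns c n" "\<mu> \<in> {0..m} \<rightarrow>\<^sub>E columns c n"
    using \<kappa> \<mu> by (auto simp: column_chains_def)
  show "\<kappa> = \<mu>"
  proof (rule PiE_ext[OF mem])
    fix i assume i: "i \<in> {0..m}"
    then have "\<kappa> i \<in> columns c n" "\<mu> i \<in> columns c n" using mem by auto
    then show "\<kappa> i = \<mu> i" unfolding columns_def by (rule PiE_ext) (use pi i in auto)
  qed
qed

lemma paths_of_surj:
  assumes "\<Theta> \<in> path_tuples"
  shows "\<exists>\<kappa>\<in>configs. paths_of \<kappa> = \<Theta>"
proof -
  have "\<exists>t. mono_on {p - 1..a + p} t \<and> t (p - 1) = 1 \<and> t (a + p) = n \<and> \<Theta> p = stair t (p - 1) (a + p)"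
    if "p \<in> {1..c}" for p
  proof -
    have "\<Theta> p \<in> lattice_paths (grid m n) down_right (p, 1) (a + p, n)"
      using assms that by (auto simp: nonintersecting_tuples_def)
    moreover have "Suc (p - 1) = p" "a + p \<le> m" using that by (auto simp: m)
    ultimately show ?thesis
      using lattice_paths_down_right[of "a + p" m 1 n n "p - 1"] by auto
  qed
  then obtain t where mono: "\<And>p. p \<in> {1..c} \<Longrightarrow> mono_on {p - 1..a + p} (t p)"
    and t0: "\<And>p. p \<in> {1..c} \<Longrightarrow> t p (p - 1) = 1" and t1: "\<And>p. p \<in> {1..c} \<Longrightarrow> t p (a + p) = n"
    and \<Theta>: "\<And>p. p \<in> {1..c} \<Longrightarrow> \<Theta> p = stair (t p) (p - 1) (a + p)"
    by metis
  have disj: "\<Theta> p \<inter> \<Theta> (Suc p) = {}" if "p \<in> {1..<c}" for p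
    using assms that by (auto simp: nonintersecting_tuples_def disjoint_family_on_def)
  \<comment> \<open>Path \<open>p + 1\<close> stays left of path \<open>p\<close>, row by row from
    its start in column \<open>1\<close>. At the first failure, the first cell of path
    \<open>p\<close> in row \<open>Suc i\<close> would also lie on path
    \<open>p + 1\<close>.\<close>
  have less: "t (Suc p) (Suc i) < t p i" if p: "p \<in> {1..<c}" and i: "p \<le> i" "i < a + p" for p i
    using i
  proof (induction i rule: dec_induct)
    case base
    show ?case
    proof (rule ccontr)
      assume "\<not> ?case"
      moreover have "t p (p - 1) \<le> t p p" "t p p \<le> t p (Suc p)"
        using p base by (auto intro!: mono_onD[OF mono])
      ultimately have "(Suc p, t p p) \<in> \<Theta> p \<inter> \<Theta> (Suc p)"
        using p base t0[of p] t0[of "Suc p"] by (auto simp: \<Theta> stair_def)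
      then show False using disj[OF p] by simp
    qed
  next
    case (step i)
    show ?case
    proof (rule ccontr)
      assume "\<not> ?case"
      moreover have "t p i \<le> t p (Suc i)" "t p (Suc i) \<le> t p (Suc (Suc i))"
        using p step by (auto intro!: mono_onD[OF mono])
      ultimately have "(Suc (Suc i), t p (Suc i)) \<in> \<Theta> p \<inter> \<Theta> (Suc p)"
        using p step by (auto simp: \<Theta> stair_def)
      then show False using disj[OF p] by simp
    qed
  qed
  \<comment> \<open>Each passage to the next path by \<open>less\<close> gains one column, down to
    path \<open>c\<close>, which starts in column \<open>1\<close>. Likewise \<open>upper\<close>
    goes back to path \<open>1\<close>, which ends in column \<open>n\<close>.\<close>
  have lower: "c + 1 - p \<le> t p i" if "p \<in> {1..c}" "p \<le> i" "i < a + p" for p i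
  proof -
    have "p \<le> c" using that by simp
    then show ?thesis using that
    proof (induction p arbitrary: i rule: inc_induct)
      case base
      then show ?case using mono_onD[OF mono[of c], of "c - 1" i] t0[of c] by auto
    next
      case (step p)
      then have "c + 1 - Suc p \<le> t (Suc p) (Suc i)" by (intro step.IH) auto
      moreover have "t (Suc p) (Suc i) < t p i" using step by (intro less) auto
      ultimately show ?case by simp
    qed
  qed
  have upper: "t p i \<le> n + 1 - p" if "p \<in> {1..c}" "p \<le> i" "i < a + p" for p i
    using that
  proof (induction p arbitrary: i)
    case (Suc p)
    show ?case
    proof (cases "p = 0")
      case True
      then show ?thesis using Suc.prems mono_onD[OF mono[of 1], of i "Suc a"] t1[of 1] by auto
    next
      case False
      obtain i' where i': "i = Suc i'" using Suc.prems by (cases i) auto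
      then have "t p i' \<le> n + 1 - p" using False Suc.prems by (intro Suc.IH) auto
      moreover have "t (Suc p) i < t p i'" unfolding i' using False Suc.prems i' by (intro less) auto
      ultimately show ?thesis by simp
    qed
  qed simp
  define g where "g i p = (if i < p then c + 1 - p else if a + p \<le> i then n + 1 - p else t p i)" for i p
  define \<kappa> where "\<kappa> = (\<lambda>i\<in>{0..m}. \<lambda>p\<in>{1..c}. g i p)"
  have \<kappa>: "\<kappa> i p = g i p" if "i \<le> m" "p \<in> {1..c}" for i p
    using that by (simp add: \<kappa>_def)
  have g_less: "g (Suc i) (Suc p) < g i p" if "p \<in> {1..<c}" for i p
    using less[of p i] that n by (auto simp: g_def)
  have g_mono: "g i p \<le> g (Suc i) p" if p: "p \<in> {1..c}" for i p
  proof -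
    consider "Suc i < p" | "Suc i = p" | "p \<le> i" "Suc i < a + p" | "p \<le> i" "Suc i = a + p" | "p \<le> i" "a + p \<le> i"
      by linarith
    then show ?thesis
    proof cases
      case 2
      then show ?thesis using lower[of p p] p n by (auto simp: g_def)
    next
      case 3
      then show ?thesis using mono_onD[OF mono[OF p], of i "Suc i"] p by (auto simp: g_def)
    next
      case 4
      then show ?thesis using upper[of p i] p by (auto simp: g_def)
    qed (auto simp: g_def)
  qed
  have g_range: "g i p \<in> {1..n}" if "p \<in> {1..c}" for i p
    using lower[of p i] upper[of p i] that n by (auto simp: g_def)
  have "\<kappa> \<in> configs"
    unfolding column_chains_def
  proof (intro CollectI conjI allI impI)
    show "\<kappa> \<in> {0..m} \<rightarrow>\<^sub>E columns c n"
      using g_range by (auto simp: \<kappa>_def columns_def)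
    show "\<kappa> 0 = start_columns"
      by (auto simp: \<kappa>_def start_columns_def g_def intro!: restrict_ext)
    show "\<kappa> m = end_columns"
      by (auto simp: \<kappa>_def end_columns_def g_def m intro!: restrict_ext)
    fix i assume "i < m"
    then show "interlace c (\<kappa> i) (\<kappa> (Suc i))"
      using g_less g_mono by (auto simp: interlace_def \<kappa>)
  qed
  moreover have "paths_of \<kappa> = \<Theta>"
  proof
    fix p
    show "paths_of \<kappa> p = \<Theta> p"
    proof (cases "p \<in> {1..c}")
      case True
      have "leave \<kappa> p i = t p i" if "i \<in> {p - 1..a + p}" for i
      proof -
        consider "i = p - 1" | "p \<le> i" "i < a + p" | "i = a + p" using \<open>i \<in> _\<close> by force
        then show ?thesis
          using True t0[OF True] t1[OF True] by cases (auto simp: leave_def \<kappa> g_def m)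
      qed
      then have "stair (leave \<kappa> p) (p - 1) (a + p) = stair (t p) (p - 1) (a + p)"
        by (intro stair_cong)
      then show ?thesis using True by (simp add: paths_of_def \<Theta>)
    next
      case False
      then show ?thesis using assms
        by (auto simp: paths_of_def nonintersecting_tuples_def PiE_iff extensional_def)
    qed
  qed
  ultimately show ?thesis by blast
qed

lemma bij_betw_paths_of: "bij_betw paths_of configs path_tuples"
  unfolding bij_betw_def using inj_on_paths_of paths_of_mem paths_of_surj by blast

text \<open>The triangle of forced cells at the left border is traversed horizontally by the tuple and
  vertically by the configuration, and likewise at the right border.\<close>

lemma Union_paths_of:
  assumes "\<kappa> \<in> configs"
  shows "(\<Union>p\<in>{1..c}. paths_of \<kappa> p)
       = {(i, j). i \<in> {1..m} \<and> j \<in> (\<Union>p\<in>{1..c}. {\<kappa> (i - 1) p..\<kappa> i p})}"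
proof (intro equalityI subsetI)
  fix z assume "z \<in> (\<Union>p\<in>{1..c}. paths_of \<kappa> p)"
  then obtain p i j where z: "z = (i, j)" and p: "p \<in> {1..c}" and i: "p \<le> i" "i \<le> a + p"
    and j: "leave \<kappa> p (i - 1) \<le> j" "j \<le> leave \<kappa> p i"
    by (auto simp: paths_of_def stair_def)
  have im: "i \<in> {1..m}" using p i by (auto simp: m)
  then have im': "i - 1 \<le> m" by auto
  have j1: "1 \<le> j" "j \<le> n"
    using j p n config_bounds[OF assms p im'] config_bounds[OF assms p, of i] im
    unfolding leave_def by (simp_all split: if_splits)
  consider "i = p" "j < c + 1 - p" | "i = a + p" "n + 1 - p < j" | "\<kappa> (i - 1) p \<le> j" "j \<le> \<kappa> i p"
  proof -
    have "\<kappa> (i - 1) p \<le> j" if "\<not> (i = p \<and> j < c + 1 - p)"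
      using that j(1) i p im config_frozen_start[OF assms p, of "i - 1"] by (auto simp: leave_def split: if_splits)
    moreover have "j \<le> \<kappa> i p" if "\<not> (i = a + p \<and> n + 1 - p < j)"
      using that j(2) i p im config_frozen_end[OF assms p, of i] by (auto simp: leave_def split: if_splits)
    ultimately show ?thesis using that by blast
  qed
  then have "\<exists>q\<in>{1..c}. \<kappa> (i - 1) q \<le> j \<and> j \<le> \<kappa> i q"
  proof cases
    \<comment> \<open>A cell of the left triangle lies on the vertical path that runs straight down
      column \<open>j\<close>, which has number \<open>c + 1 - j\<close>.\<close>
    case 1
    then show ?thesis
      using p j1 im config_frozen_start[OF assms, of "c + 1 - j" "i - 1"] config_frozen_start[OF assms, of "c + 1 - j" i]
      by (intro bexI[of _ "c + 1 - j"]) auto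
  next
    \<comment> \<open>In the right triangle the vertical path in column \<open>j\<close> has number
      \<open>n + 1 - j\<close>.\<close>
    case 2
    then have q: "n + 1 - j \<in> {1..c}" "a + (n + 1 - j) \<le> i - 1" "i \<le> m"
      using p j1 n im by auto
    then have "\<kappa> (i - 1) (n + 1 - j) = n + 1 - (n + 1 - j)" "\<kappa> i (n + 1 - j) = n + 1 - (n + 1 - j)"
      using im' by (intro config_frozen_end[OF assms]; linarith)+
    then show ?thesis using q(1) j1 by (intro bexI[of _ "n + 1 - j"]) auto
  qed (use p in auto)
  then show "z \<in> {(i, j). i \<in> {1..m} \<and> j \<in> (\<Union>p\<in>{1..c}. {\<kappa> (i - 1) p..\<kappa> i p})}"
    using z im by auto
next
  fix z assume "z \<in> {(i, j). i \<in> {1..m} \<and> j \<in> (\<Union>p\<in>{1..c}. {\<kappa> (i - 1) p..\<kappa> i p})}"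
  then obtain q i j where z: "z = (i, j)" and q: "q \<in> {1..c}" and i: "i \<in> {1..m}"
    and j: "\<kappa> (i - 1) q \<le> j" "j \<le> \<kappa> i q" by auto
  note bounds = config_bounds[OF assms]
  consider "i < q" | "q \<le> i" "i \<le> a + q" | "a + q < i" by linarith
  then have "\<exists>p\<in>{1..c}. p \<le> i \<and> i \<le> a + p \<and> leave \<kappa> p (i - 1) \<le> j \<and> j \<le> leave \<kappa> p i"
  proof cases
    \<comment> \<open>Path \<open>q\<close> is still frozen here; its cell in row \<open>i\<close>
      belongs to the horizontal path that starts in this row, path \<open>i\<close>.\<close>
    case 1
    then have "j = c + 1 - q"
      using j q i config_frozen_start[OF assms q, of "i - 1"] config_frozen_start[OF assms q, of i] by auto
    then show ?thesis using 1 q i bounds[of i i]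
      by (intro bexI[of _ i]) (use n in \<open>auto simp: leave_def\<close>)
  next
    case 2
    then show ?thesis using q i j bounds[OF q, of i] bounds[OF q, of "i - 1"]
      by (intro bexI[of _ q]) (use n in \<open>auto simp: leave_def\<close>)
  next
    \<comment> \<open>Path \<open>q\<close> is frozen again; its cell belongs to the horizontal path
      that ends in row \<open>i\<close>, path \<open>i - a\<close>.\<close>
    case 3
    then have "j = n + 1 - q"
      using j q i config_frozen_end[OF assms q, of "i - 1"] config_frozen_end[OF assms q, of i] by auto
    moreover have ia: "i - a \<in> {1..c}" "i - 1 \<le> m" using 3 q i m by auto
    moreover have "n + 1 - (i - a) \<le> n + 1 - q" "n + 1 - q \<in> {1..n}" using 3 q n by auto
    ultimately have "\<kappa> (i - 1) (i - a) \<le> j" "j \<in> {1..n}"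
      using bounds(2)[OF ia] by auto
    then show ?thesis
      using 3 ia by (intro bexI[of _ "i - a"]) (auto simp: leave_def)
  qed
  then show "z \<in> (\<Union>p\<in>{1..c}. paths_of \<kappa> p)"
    using z by (fastforce simp: paths_of_def stair_def)
qed

text \<open>The cells are grouped by rows. Within a row the intervals of different paths are
  disjoint by \<open>interlace_less\<close>, so no cell is counted twice.\<close>

lemma prod_paths_of:
  fixes f :: "nat \<Rightarrow> nat \<Rightarrow> 'a::comm_monoid_mult"
  assumes "\<kappa> \<in> configs"
  shows "(\<Prod>(i, j)\<in>(\<Union>p\<in>{1..c}. paths_of \<kappa> p). f i j)
       = (\<Prod>i<m. \<Prod>p\<in>{1..c}. \<Prod>j\<in>{\<kappa> i p..\<kappa> (Suc i) p}. f (Suc i) j)"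
proof -
  let ?R = "\<lambda>i. \<Union>p\<in>{1..c}. {\<kappa> (i - 1) p..\<kappa> i p}"
  have "(\<Union>p\<in>{1..c}. paths_of \<kappa> p) = Sigma {1..m} ?R"
    unfolding Union_paths_of[OF assms] by auto
  then have "(\<Prod>(i, j)\<in>(\<Union>p\<in>{1..c}. paths_of \<kappa> p). f i j) = (\<Prod>i\<in>{1..m}. \<Prod>j\<in>?R i. f i j)"
    by (simp add: prod.Sigma)
  also have "\<dots> = (\<Prod>i<m. \<Prod>j\<in>?R (Suc i). f (Suc i) j)"
    by (rule prod.reindex_bij_witness[of _ Suc "\<lambda>i. i - 1"]) auto
  also have "\<dots> = (\<Prod>i<m. \<Prod>p\<in>{1..c}. \<Prod>j\<in>{\<kappa> i p..\<kappa> (Suc i) p}. f (Suc i) j)"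
  proof (rule prod.cong[OF refl])
    fix i assume "i \<in> {..<m}"
    then have less: "\<kappa> (Suc i) q < \<kappa> i p" if "p \<in> {1..c}" "q \<in> {1..c}" "p < q" for p q
      using that by (intro interlace_less[OF config_interlace[OF assms]]) auto
    have "{\<kappa> i p..\<kappa> (Suc i) p} \<inter> {\<kappa> i q..\<kappa> (Suc i) q} = {}" if "p \<in> {1..c}" "q \<in> {1..c}" "p \<noteq> q" for p q
      using less[of p q] less[of q p] that by (cases p q rule: linorder_cases) auto
    then show "(\<Prod>j\<in>?R (Suc i). f (Suc i) j) = (\<Prod>p\<in>{1..c}. \<Prod>j\<in>{\<kappa> i p..\<kappa> (Suc i) p}. f (Suc i) j)"
      by (subst prod.UNION_disjoint) auto
  qed
  finally show ?thesis .
qed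

lemma sum_path_tuples:
  fixes y X :: "nat \<Rightarrow> 'a::field"
  shows "(\<Sum>\<Theta>\<in>path_tuples. \<Prod>(i, j)\<in>(\<Union>p\<in>{1..c}. \<Theta> p). 1 / (X i - y j))
       = transfer c n y (map X [1..<Suc m]) start_columns end_columns"
  unfolding transfer_eq_sum_chains[OF start_columns_mem end_columns_mem]
  by (subst sum.reindex_bij_betw[OF bij_betw_paths_of, symmetric])
     (intro sum.cong refl prod_paths_of)

text \<open>Reversing the row variables reverses the list of matrices, which leaves their product
  unchanged by \<open>transfer_rev\<close>.\<close>

lemma sum_path_tuples_rev:
  fixes y X :: "nat \<Rightarrow> 'a::field"
  assumes "\<And>i j. X i \<noteq> y j"
  shows "(\<Sum>\<Theta>\<in>path_tuples. \<Prod>(i, j)\<in>(\<Union>p\<in>{1..c}. \<Theta> p). 1 / (X (m + 1 - i) - y j))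
       = (\<Sum>\<Theta>\<in>path_tuples. \<Prod>(i, j)\<in>(\<Union>p\<in>{1..c}. \<Theta> p). 1 / (X i - y j))"
proof -
  have "map (\<lambda>i. X (m + 1 - i)) [1..<Suc m] = rev (map X [1..<Suc m])"
    by (rule nth_equalityI) (auto simp: rev_nth Suc_diff_Suc simp del: upt_Suc)
  then show ?thesis
    unfolding sum_path_tuples[of "\<lambda>i. X (m + 1 - i)"] sum_path_tuples[of X]
    by (simp only:) (rule transfer_rev[OF start_columns_mem end_columns_mem], use assms in auto)
qed

section \<open>Reflection of the rows of the grid\<close>

definition flip :: "cell \<Rightarrow> cell" where
  "flip z = (m + 1 - fst z, snd z)"

text \<open>The path numbers are reversed as well: with \<open>m = a + c\<close>, the cell
  \<open>(a + p, 1)\<close> is reflected to \<open>(c + 1 - p, 1)\<close>, the start of path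
  \<open>c + 1 - p\<close> of the other kind.\<close>

definition flip_tuple :: "(nat \<Rightarrow> cell set) \<Rightarrow> nat \<Rightarrow> cell set" where
  "flip_tuple \<Gamma> = (\<lambda>p\<in>{1..c}. flip ` \<Gamma> (c + 1 - p))"

lemma flip_flip: "z \<in> grid m n \<Longrightarrow> flip (flip z) = z"
  by (auto simp: flip_def grid_def)

lemma inj_on_flip: "inj_on flip (grid m n)"
  by (metis flip_flip inj_onI)

lemma flip_lattice_paths:
  assumes "P \<in> lattice_paths (grid m n) step s t"
    and "\<And>u v. u \<in> grid m n \<Longrightarrow> v \<in> grid m n \<Longrightarrow> step u v \<Longrightarrow> step' (flip u) (flip v)"
  shows "flip ` P \<in> lattice_paths (grid m n) step' (flip s) (flip t)"
proof -
  obtain cs where cs: "P = set cs" "cs \<noteq> []" "hd cs = s" "last cs = t" "successively step cs" "set cs \<subseteq> grid m n"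
    using assms(1) by (auto simp: lattice_paths_def)
  have "successively (\<lambda>u v. step' (flip u) (flip v)) cs"
    using cs(5) by (rule successively_mono) (meson assms(2) cs(6) subsetD)
  moreover have "flip ` set cs \<subseteq> grid m n" using cs(6) by (fastforce simp: flip_def grid_def)
  ultimately show ?thesis
    unfolding lattice_paths_def using cs
    by (intro CollectI exI[of _ "map flip cs"]) (auto simp: successively_map hd_map last_map)
qed

lemma flip_tuple_mem:
  assumes "\<Gamma> \<in> nonintersecting_tuples c (\<lambda>p. lattice_paths (grid m n) step (s p) (t p))"
    and "\<And>u v. u \<in> grid m n \<Longrightarrow> v \<in> grid m n \<Longrightarrow> step u v \<Longrightarrow> step' (flip u) (flip v)"
    and "\<And>p. p \<in> {1..c} \<Longrightarrow> s' p = flip (s (c + 1 - p)) \<and> t' p = flip (t (c + 1 - p))"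
  shows "flip_tuple \<Gamma> \<in> nonintersecting_tuples c (\<lambda>p. lattice_paths (grid m n) step' (s' p) (t' p))"
proof -
  have \<Gamma>: "\<Gamma> p \<in> lattice_paths (grid m n) step (s p) (t p)" if "p \<in> {1..c}" for p
    using that assms(1) by (auto simp: nonintersecting_tuples_def)
  note sub = tuple_subset_grid[OF assms(1)]
  have "flip ` \<Gamma> (c + 1 - p) \<in> lattice_paths (grid m n) step' (s' p) (t' p)" if "p \<in> {1..c}" for p
  proof -
    have "c + 1 - p \<in> {1..c}" using that by auto
    from flip_lattice_paths[OF \<Gamma>[OF this], of step'] show ?thesis
      using assms(2) assms(3)[OF that] by metis
  qed
  moreover have "flip ` \<Gamma> (c + 1 - p) \<inter> flip ` \<Gamma> (c + 1 - q) = {}"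
    if "p \<in> {1..c}" "q \<in> {1..c}" "p \<noteq> q" for p q
  proof -
    have pq: "c + 1 - p \<in> {1..c}" "c + 1 - q \<in> {1..c}" "c + 1 - p \<noteq> c + 1 - q" using that by auto
    then have "\<Gamma> (c + 1 - p) \<inter> \<Gamma> (c + 1 - q) = {}"
      using assms(1) unfolding nonintersecting_tuples_def disjoint_family_on_def by blast
    then show ?thesis
      using inj_on_image_Int[OF inj_on_flip sub[OF pq(1)] sub[OF pq(2)]] by simp
  qed
  ultimately show ?thesis
    by (auto simp: nonintersecting_tuples_def flip_tuple_def disjoint_family_on_def)
qed

lemma flip_tuple_flip_tuple:
  assumes "\<Gamma> \<in> nonintersecting_tuples c (\<lambda>p. lattice_paths (grid m n) step (s p) (t p))"
  shows "flip_tuple (flip_tuple \<Gamma>) = \<Gamma>"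
proof
  fix p
  show "flip_tuple (flip_tuple \<Gamma>) p = \<Gamma> p"
  proof (cases "p \<in> {1..c}")
    case True
    then have "\<Gamma> p \<subseteq> grid m n" by (rule tuple_subset_grid[OF assms])
    then have "flip ` flip ` \<Gamma> p = \<Gamma> p"
      using flip_flip by (force simp: image_image)
    then show ?thesis using True by (auto simp: flip_tuple_def)
  next
    case False
    then show ?thesis using assms
      by (auto simp: nonintersecting_tuples_def PiE_iff extensional_def flip_tuple_def)
  qed
qed

text \<open>Renumbering the paths keeps their union, and \<open>flip\<close> is injective on the
  grid, so the product can be reindexed cell by cell.\<close>

lemma prod_flip_tuple:
  fixes f :: "nat \<Rightarrow> nat \<Rightarrow> 'a::comm_monoid_mult"
  assumes "\<Gamma> \<in> nonintersecting_tuples c (\<lambda>p. lattice_paths (grid m n) step (s p) (t p))"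
  shows "(\<Prod>(i, j)\<in>(\<Union>p\<in>{1..c}. flip_tuple \<Gamma> p). f (m + 1 - i) j) = (\<Prod>(i, j)\<in>(\<Union>p\<in>{1..c}. \<Gamma> p). f i j)"
proof -
  have sub: "(\<Union>p\<in>{1..c}. \<Gamma> p) \<subseteq> grid m n"
    using tuple_subset_grid[OF assms] by blast
  have "(\<Union>p\<in>{1..c}. flip_tuple \<Gamma> p) = flip ` (\<Union>p\<in>{1..c}. \<Gamma> (c + 1 - p))"
    by (auto simp: flip_tuple_def)
  also have "(\<Union>p\<in>{1..c}. \<Gamma> (c + 1 - p)) = (\<Union>p\<in>(\<lambda>p. c + 1 - p) ` {1..c}. \<Gamma> p)"
    by simp
  also have "(\<lambda>p. c + 1 - p) ` {1..c} = {1..c}"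
  proof (intro equalityI subsetI)
    fix q assume "q \<in> {1..c}"
    then show "q \<in> (\<lambda>p. c + 1 - p) ` {1..c}" by (intro image_eqI[of _ _ "c + 1 - q"]) auto
  qed auto
  finally have "(\<Union>p\<in>{1..c}. flip_tuple \<Gamma> p) = flip ` (\<Union>p\<in>{1..c}. \<Gamma> p)" .
  then have "(\<Prod>(i, j)\<in>(\<Union>p\<in>{1..c}. flip_tuple \<Gamma> p). f (m + 1 - i) j)
    = (\<Prod>z\<in>(\<Union>p\<in>{1..c}. \<Gamma> p). f (m + 1 - fst (flip z)) (snd (flip z)))"
    using prod.reindex[OF inj_on_subset[OF inj_on_flip sub]] by (simp add: case_prod_beta)
  also have "\<dots> = (\<Prod>(i, j)\<in>(\<Union>p\<in>{1..c}. \<Gamma> p). f i j)"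
    using sub by (intro prod.cong refl) (auto simp: flip_def grid_def)
  finally show ?thesis .
qed

lemma sum_up_right_tuples:
  fixes f :: "nat \<Rightarrow> nat \<Rightarrow> 'a::comm_semiring_1"
  shows "(\<Sum>\<Gamma>\<in>nonintersecting_tuples c (\<lambda>p. lattice_paths (grid m n) up_right (a + p, 1) (p, n)).
      \<Prod>(i, j)\<in>(\<Union>p\<in>{1..c}. \<Gamma> p). f i j)
    = (\<Sum>\<Theta>\<in>path_tuples. \<Prod>(i, j)\<in>(\<Union>p\<in>{1..c}. \<Theta> p). f (m + 1 - i) j)"
proof (rule sum.reindex_bij_witness[of _ flip_tuple flip_tuple])
  fix \<Gamma> assume "\<Gamma> \<in> nonintersecting_tuples c (\<lambda>p. lattice_paths (grid m n) up_right (a + p, 1) (p, n))"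
  note \<Gamma> = this
  show "flip_tuple (flip_tuple \<Gamma>) = \<Gamma>" by (rule flip_tuple_flip_tuple[OF \<Gamma>])
  show "flip_tuple \<Gamma> \<in> path_tuples"
    by (rule flip_tuple_mem[OF \<Gamma>]) (unfold flip_def, auto simp: up_right_def down_right_def grid_def m)
  show "(\<Prod>(i, j)\<in>(\<Union>p\<in>{1..c}. flip_tuple \<Gamma> p). f (m + 1 - i) j) = (\<Prod>(i, j)\<in>(\<Union>p\<in>{1..c}. \<Gamma> p). f i j)"
    by (rule prod_flip_tuple[OF \<Gamma>])
next
  fix \<Theta> assume \<Theta>: "\<Theta> \<in> path_tuples"
  show "flip_tuple (flip_tuple \<Theta>) = \<Theta>" by (rule flip_tuple_flip_tuple[OF \<Theta>])
  show "flip_tuple \<Theta> \<in> nonintersecting_tuples c (\<lambda>p. lattice_paths (grid m n) up_right (a + p, 1) (p, n))"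
    by (rule flip_tuple_mem[OF \<Theta>]) (unfold flip_def, auto simp: up_right_def down_right_def grid_def m)
qed

end

theorem theorem3p10:
  fixes a b c :: nat
  assumes "c \<ge> 1"
  shows "(\<Sum>\<Gamma>\<in>nonintersecting_tuples c
             (\<lambda>p. lattice_paths (grid (a + c) (b + c)) up_right (a + p, 1) (p, b + c)).
           tuple_weight c \<Gamma>)
       = (\<Sum>\<Theta>\<in>nonintersecting_tuples c
             (\<lambda>p. lattice_paths (grid (a + c) (b + c)) down_right (p, 1) (a + p, b + c)).
           (tuple_weight c \<Theta> :: 'k::field ratfun))"
proof -
  interpret path_grid a c "a + c" "b + c" by unfold_locales simp_all
  show ?thesis
    \<comment> \<open>Reflection turns the left side into the sum over the tuples on the right with
      the \<open>xvar\<close> reversed. Distinctness of \<open>xvar i\<close> and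
      \<open>yvar j\<close> then makes the reversal harmless.\<close>
    unfolding tuple_weight_def sum_up_right_tuples
    by (rule sum_path_tuples_rev) (rule xvar_neq_yvar)
qed

end
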